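(* Let $T$ be a nondegenerate tile, $q\ge 2$ an integer, $t\in\mathbb Z/q\mathbb Z$, and $w:T\to\mathbb Z/q\mathbb Z$ a function with $w(c_1e_1)$ and $w(c_2e_2)$ invertible in $\mathbb Z/q\mathbb Z$. Let $\Lambda(T,q,t,w)$ be the associated $2$-graph. Then for each $p\in(\mathbb Z/q\mathbb Z)^P$ there is a bijection $f_p:\mathbb Z/q\mathbb Z\to\mathbb Z/q\mathbb Z$ such that $\Lambda(T,q,t,w)\cong\Lambda_{BD}$, where $BD=(T,\mathbb Z/q\mathbb Z,\{f_p:p\in(\mathbb Z/q\mathbb Z)^P\})$.
   Context: $\mathbb N=\{0,1,2,\dots\}$; $\mathbb N^2$ is a semigroup under addition with basis $e_1,e_2$ and the coordinatewise partial order $\le$. A tile $T$ is a nonempty finite subset of $\mathbb N^2$ that is hereditary ($n\in T$ and $0\le m\le n$ imply $m\in T$); $(c_1,c_2)$ denotes the coordinatewise maximum of the elements of $T$; $T$ is nondegenerate if $|T|\ge 2$. For nondegenerate $T$ put $P=T\setminus\{c_1e_1,c_2e_2\}$. Basic data is a triple $BD=(T,A,\{f_p:p\in A^P\})$ where $T$ is a nondegenerate tile, $A$ is a finite nonempty set, and for each function $p\in A^P$ (with $A^\emptyset=\{\emptyset\}$), $f_p:A\to A$ is a bijection. For $p\in A^P$, $a\in A$ define $F_{p,a}:T\to A$ by $F_{p,a}(c_2e_2)=a$, $F_{p,a}(c_1e_1)=f_p(a)$, $F_{p,a}(t)=p(t)$ for $t\in P$, and let $\Lambda_{BD}^0=\{F_{p,a}:p\in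 A^P,a\in A\}$. For $S\subset\mathbb N^2$, $n\in\mathbb N^2$ let $S+n=\{m+n:m\in S\}$, and $T(n)=\bigcup_{0\le m\le n}(T+m)$. If $f:S\to A$ with $T+n\subset S$, define $f\downarrow_{T+n}:T\to A$ by $f\downarrow_{T+n}(i)=f(i+n)$. A path of degree $n\in\mathbb N^2$ is a function $\lambda:T(n)\to A$ with $\lambda\downarrow_{T+m}\in\Lambda_{BD}^0$ for all $0\le m\le n$; its range is $r(\lambda)=\lambda\downarrow_T$ and its source is $s(\lambda)=\lambda\downarrow_{T+n}$. For $\lambda$ of degree $\ell$ and $0\le m\le n\le\ell$, $\lambda(m,n)$ is the path of degree $n-m$ given by $\lambda(m,n)(i)=\lambda(m+i)$ for $i\in T(n-m)$. The $2$-graph $\Lambda_{BD}$ is the category with objects $\Lambda_{BD}^0$, morphisms all paths, degree map $d$, and composite $\mu\nu$ (for $s(\mu)=r(\nu)$) the unique path $\lambda$ of degree $d(\mu)+d(\nu)$ with $\lambda(0,d(\mu))=\mu$, $\lambda(d(\mu),d(\mu)+d(\nu))=\nu$. For $(T,q,t,w)$ as in the claim, the $2$-graph $\Lambda(T,q,t,w)$ (of Pask, Raeburn and Weaver) has vertex set consisting of the functions $v:T\to\mathbb Z/q\mathbb Z$ with $\sum_{i\in T}v(i)w(i)=t$ in $\mathbb Z/q\mathbb Z$; its paths of degree $n$ are the functions $\lambda:T(n)\to\mathbb Z/q\mathbb Z$ such that $\lambda\downarrow_{T+m}$ is a vertex for all $0\le m\le n$; and range, source, degree, factorisations $\lambda(m,n)$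 and composition are defined by the same formulas as for $\Lambda_{BD}$. $\cong$ denotes isomorphism of $2$-graphs (a degree-preserving isomorphism of categories). *)

theory Defs
  imports
    "HOL-Number_Theory.Residues"
    "HOL-Library.FuncSet"
    "HOL-Library.Product_Plus"
    "HOL-Library.Product_Order"
begin

text \<open>
  The semigroup of pairs of naturals is the type \<^typ>\<open>nat \<times> nat\<close>, whose addition and order are
  the coordinatewise ones. Functions with domain \<open>S\<close> and values in \<open>A\<close> are the
  extensional functions \<open>S \<rightarrow>\<^sub>E A\<close>; in particular \<open>{} \<rightarrow>\<^sub>E A\<close> is a singleton.
\<close>

section \<open>Tiles\<close>

definition tile :: "(nat \<times> nat) set \<Rightarrow> bool" where
  "tile T \<longleftrightarrow> finite T \<and> T \<noteq> {} \<and> (\<forall>n\<in>T. \<forall>m. m \<le> n \<longrightarrow> m \<in> T)"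

definition nondegenerate :: "(nat \<times> nat) set \<Rightarrow> bool" where
  "nondegenerate T \<longleftrightarrow> card T \<ge> 2"

text \<open>The points $c_1 e_1$ and $c_2 e_2$, where $(c_1,c_2)$ is the coordinatewise
  maximum of \<open>T\<close>.\<close>

definition corner1 :: "(nat \<times> nat) set \<Rightarrow> nat \<times> nat" where
  "corner1 T = (Max (fst ` T), 0)"

definition corner2 :: "(nat \<times> nat) set \<Rightarrow> nat \<times> nat" where
  "corner2 T = (0, Max (snd ` T))"

definition punctured :: "(nat \<times> nat) set \<Rightarrow> (nat \<times> nat) set" where
  "punctured T = T - {corner1 T, corner2 T}"

definition region :: "(nat \<times> nat) set \<Rightarrow> nat \<times> nat \<Rightarrow> (nat \<times> nat) set" where
  "region T n = (\<Union>m\<in>{0..n}. (\<lambda>i. i + m) ` T)"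

definition window :: "(nat \<times> nat) set \<Rightarrow> nat \<times> nat \<Rightarrow> (nat \<times> nat \<Rightarrow> 'a) \<Rightarrow> nat \<times> nat \<Rightarrow> 'a" where
  "window T n f = (\<lambda>i\<in>T. f (i + n))"

section \<open>Graphs of rank two and their isomorphisms\<close>

text \<open>
  The data of a small category with a degree map. The composite \<open>Comp G \<mu> \<nu>\<close> is meaningful
  for morphisms with \<open>Src G \<mu> = Rng G \<nu>\<close>.
\<close>

record ('o, 'm) two_graph =
  Obj :: "'o set"
  Mor :: "'m set"
  Rng :: "'m \<Rightarrow> 'o"
  Src :: "'m \<Rightarrow> 'o"
  Ident :: "'o \<Rightarrow> 'm"
  Comp :: "'m \<Rightarrow> 'm \<Rightarrow> 'm"
  Deg :: "'m \<Rightarrow> nat \<times> nat"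

definition two_graph_isomorphic ::
  "('o, 'm) two_graph \<Rightarrow> ('p, 'n) two_graph \<Rightarrow> bool" (infix "\<cong>\<^sub>2" 50) where
  "G \<cong>\<^sub>2 H \<longleftrightarrow> (\<exists>\<phi>0 \<phi>.
     bij_betw \<phi>0 (Obj G) (Obj H) \<and>
     bij_betw \<phi> (Mor G) (Mor H) \<and>
     (\<forall>\<mu>\<in>Mor G. Rng H (\<phi> \<mu>) = \<phi>0 (Rng G \<mu>) \<and> Src H (\<phi> \<mu>) = \<phi>0 (Src G \<mu>)) \<and>
     (\<forall>v\<in>Obj G. \<phi> (Ident G v) = Ident H (\<phi>0 v)) \<and>
     (\<forall>\<mu>\<in>Mor G. \<forall>\<nu>\<in>Mor G. Src G \<mu> = Rng G \<nu> \<longrightarrow>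
        \<phi> (Comp G \<mu> \<nu>) = Comp H (\<phi> \<mu>) (\<phi> \<nu>)) \<and>
     (\<forall>\<mu>\<in>Mor G. Deg H (\<phi> \<mu>) = Deg G \<mu>))"

section \<open>Paths over a set of vertices\<close>

text \<open>
  Both graphs below arise in the same way from a set \<open>V\<close> of functions from \<open>T\<close> to \<open>A\<close>.
\<close>

definition paths ::
  "(nat \<times> nat) set \<Rightarrow> 'a set \<Rightarrow> (nat \<times> nat \<Rightarrow> 'a) set \<Rightarrow> nat \<times> nat \<Rightarrow> (nat \<times> nat \<Rightarrow> 'a) set" where
  "paths T A V n = {g \<in> region T n \<rightarrow>\<^sub>E A. \<forall>m\<in>{0..n}. window T m g \<in> V}"

text \<open>The factor $\lambda(m,n)$, for $0 \le m \le n \le d(\lambda)$.\<close>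

definition segment ::
  "(nat \<times> nat) set \<Rightarrow> (nat \<times> nat \<Rightarrow> 'a) \<Rightarrow> nat \<times> nat \<Rightarrow> nat \<times> nat \<Rightarrow> nat \<times> nat \<Rightarrow> 'a" where
  "segment T f m n = (\<lambda>i\<in>region T (n - m). f (m + i))"

text \<open>
  A morphism is a pair of a degree \<open>n\<close> and a path of degree \<open>n\<close>. For a tile \<open>T\<close> the domain
  \<open>region T n\<close> determines \<open>n\<close>, so the first component carries no extra information. Since
  \<open>region T 0 = T\<close>, a vertex is itself a path of degree \<open>0\<close>, its own identity morphism.
\<close>

definition path_graph ::
  "(nat \<times> nat) set \<Rightarrow> 'a set \<Rightarrow> (nat \<times> nat \<Rightarrow> 'a) set \<Rightarrow>
     (nat \<times> nat \<Rightarrow> 'a, (nat \<times> nat) \<times> (nat \<times> nat \<Rightarrow> 'a)) two_graph" where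
  "path_graph T A V =
     \<lparr> Obj = V,
       Mor = {(n, g). g \<in> paths T A V n},
       Rng = (\<lambda>(n, g). window T 0 g),
       Src = (\<lambda>(n, g). window T n g),
       Ident = (\<lambda>v. (0, v)),
       Comp = (\<lambda>(m, \<mu>) (n, \<nu>).
         (m + n, THE g. g \<in> paths T A V (m + n) \<and>
                        segment T g 0 m = \<mu> \<and> segment T g m (m + n) = \<nu>)),
       Deg = fst \<rparr>"

section \<open>The graph of basic data\<close>

definition basic_data ::
  "(nat \<times> nat) set \<Rightarrow> 'a set \<Rightarrow> ((nat \<times> nat \<Rightarrow> 'a) \<Rightarrow> 'a \<Rightarrow> 'a) \<Rightarrow> bool" where
  "basic_data T A f \<longleftrightarrow> tile T \<and> nondegenerate T \<and> finite A \<and> A \<noteq> {} \<and>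
     (\<forall>p \<in> punctured T \<rightarrow>\<^sub>E A. bij_betw (f p) A A)"

text \<open>The function $F_{p,a}$; the two corners are distinct when \<open>T\<close> is a nondegenerate tile.\<close>

definition bd_vertex ::
  "(nat \<times> nat) set \<Rightarrow> ((nat \<times> nat \<Rightarrow> 'a) \<Rightarrow> 'a \<Rightarrow> 'a) \<Rightarrow> (nat \<times> nat \<Rightarrow> 'a) \<Rightarrow> 'a \<Rightarrow>
     nat \<times> nat \<Rightarrow> 'a" where
  "bd_vertex T f p a =
     (\<lambda>i\<in>T. if i = corner2 T then a else if i = corner1 T then f p a else p i)"

definition bd_vertices ::
  "(nat \<times> nat) set \<Rightarrow> 'a set \<Rightarrow> ((nat \<times> nat \<Rightarrow> 'a) \<Rightarrow> 'a \<Rightarrow> 'a) \<Rightarrow> (nat \<times> nat \<Rightarrow> 'a) set" where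
  "bd_vertices T A f = {bd_vertex T f p a | p a. p \<in> punctured T \<rightarrow>\<^sub>E A \<and> a \<in> A}"

definition bd_graph ::
  "(nat \<times> nat) set \<Rightarrow> 'a set \<Rightarrow> ((nat \<times> nat \<Rightarrow> 'a) \<Rightarrow> 'a \<Rightarrow> 'a) \<Rightarrow>
     (nat \<times> nat \<Rightarrow> 'a, (nat \<times> nat) \<times> (nat \<times> nat \<Rightarrow> 'a)) two_graph" where
  "bd_graph T A f = path_graph T A (bd_vertices T A f)"

section \<open>The graph of Pask, Raeburn and Weaver\<close>

text \<open>
  The ring of integers modulo \<open>q\<close> is \<^term>\<open>residue_ring q\<close>, with carrier \<open>{0..q - 1}\<close>.
\<close>

definition prw_vertices ::
  "(nat \<times> nat) set \<Rightarrow> int \<Rightarrow> int \<Rightarrow> (nat \<times> nat \<Rightarrow> int) \<Rightarrow> (nat \<times> nat \<Rightarrow> int) set" where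
  "prw_vertices T q t w =
     {v \<in> T \<rightarrow>\<^sub>E carrier (residue_ring q).
        (\<Oplus>\<^bsub>residue_ring q\<^esub>i\<in>T. v i \<otimes>\<^bsub>residue_ring q\<^esub> w i) = t}"

definition prw_graph ::
  "(nat \<times> nat) set \<Rightarrow> int \<Rightarrow> int \<Rightarrow> (nat \<times> nat \<Rightarrow> int) \<Rightarrow>
     (nat \<times> nat \<Rightarrow> int, (nat \<times> nat) \<times> (nat \<times> nat \<Rightarrow> int)) two_graph" where
  "prw_graph T q t w = path_graph T (carrier (residue_ring q)) (prw_vertices T q t w)"

end

theory Submission
  imports Defs
begin

text \<open>
  Both graphs are built by the same construction \<^const>\<open>path_graph\<close> from a set of functions
  \<open>T \<rightarrow> \<int>/q\<close>, so it suffices to choose the bijections \<open>f\<^sub>p\<close> for which the two vertex sets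
  coincide; the identity is then an isomorphism. Split off the two corners from the
  vertex condition of Pask, Raeburn and Weaver:
  \[ v(c_1e_1)\,w(c_1e_1) + v(c_2e_2)\,w(c_2e_2) + \sum_{i \in P} v(i)\,w(i) = t. \]
  As $w(c_1e_1)$ is invertible, this equation has exactly one solution $v(c_1e_1)$ for given
  \<open>p = v|\<^sub>P\<close> and $a = v(c_2e_2)$, and \<open>f\<^sub>p a\<close> is that solution (\<open>prw_vertices_eq_bd_vertices\<close>).
  As $w(c_2e_2)$ is invertible too, $a$ is recovered from \<open>f\<^sub>p a\<close> by the same
  argument, whence \<open>f\<^sub>p\<close> is a bijection (\<open>bij_betw_corner_solution\<close>).
\<close>

section \<open>Corners of a tile\<close>

lemma corner1_in_tile:
  assumes "tile T"
  shows "corner1 T \<in> T"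
proof -
  have "Max (fst ` T) \<in> fst ` T"
    using assms by (intro Max_in) (auto simp: tile_def)
  then obtain y where "(Max (fst ` T), y) \<in> T"
    by force
  moreover have "(Max (fst ` T), 0) \<le> (Max (fst ` T), y)"
    by simp
  ultimately show ?thesis
    using assms unfolding tile_def corner1_def by blast
qed

lemma corner2_in_tile:
  assumes "tile T"
  shows "corner2 T \<in> T"
proof -
  have "Max (snd ` T) \<in> snd ` T"
    using assms by (intro Max_in) (auto simp: tile_def)
  then obtain x where "(x, Max (snd ` T)) \<in> T"
    by force
  moreover have "(0, Max (snd ` T)) \<le> (x, Max (snd ` T))"
    by simp
  ultimately show ?thesis
    using assms unfolding tile_def corner2_def by blast
qed

text \<open>
  The corners lie on different axes, so they can only coincide at the origin; then both
  coordinatewise maxima vanish and the tile is a single point.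
\<close>

lemma corners_distinct:
  assumes "tile T" "nondegenerate T"
  shows "corner1 T \<noteq> corner2 T"
proof
  assume "corner1 T = corner2 T"
  then have max0: "Max (fst ` T) = 0" "Max (snd ` T) = 0"
    by (auto simp: corner1_def corner2_def)
  have fin: "finite T"
    using assms(1) by (simp add: tile_def)
  have "x = (0, 0)" if "x \<in> T" for x
    using Max_ge[of "fst ` T" "fst x"] Max_ge[of "snd ` T" "snd x"] fin that max0
    by (simp add: prod_eq_iff)
  then have "T \<subseteq> {(0, 0)}"
    by blast
  then have "card T \<le> card {(0::nat, 0::nat)}"
    by (intro card_mono) auto
  then show False
    using assms(2) by (simp add: nondegenerate_def)
qed

section \<open>Solving the vertex equation for a corner value\<close>

context cring
begin

lemma linear_eq_iff_unique_solution:
  assumes "u \<in> Units R" "b \<in> carrier R" "c \<in> carrier R" "t \<in> carrier R"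
  shows "b \<otimes> u \<oplus> c = t \<longleftrightarrow> b = (t \<ominus> c) \<otimes> inv u"
proof -
  have u: "u \<in> carrier R" "inv u \<in> carrier R" "u \<otimes> inv u = \<one>" "inv u \<otimes> u = \<one>"
    using assms(1) by auto
  show ?thesis
  proof
    assume "b \<otimes> u \<oplus> c = t"
    then have "(t \<ominus> c) \<otimes> inv u = (b \<otimes> u \<oplus> c \<ominus> c) \<otimes> inv u"
      by simp
    also have "\<dots> = b \<otimes> (u \<otimes> inv u)"
      using assms u(1,2) by algebra
    finally show "b = (t \<ominus> c) \<otimes> inv u"
      using u assms by simp
  next
    assume "b = (t \<ominus> c) \<otimes> inv u"
    then have "b \<otimes> u \<oplus> c = (t \<ominus> c) \<otimes> (inv u \<otimes> u) \<oplus> c"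
      using assms u(1,2) by (simp add: m_assoc)
    also have "\<dots> = (t \<ominus> c) \<oplus> c"
      using u assms by simp
    also have "\<dots> = t"
      using assms by algebra
    finally show "b \<otimes> u \<oplus> c = t" .
  qed
qed

text \<open>
  The function in question sends \<open>a\<close> to the solution \<open>b\<close> of \<open>b u + (a v + s) = t\<close>. The equation
  is symmetric in \<open>(b, u)\<close> and \<open>(a, v)\<close>, so solving it for \<open>a\<close> gives the inverse function.
\<close>

lemma bij_betw_corner_solution:
  assumes u: "u \<in> Units R" and v: "v \<in> Units R" and s: "s \<in> carrier R" and t: "t \<in> carrier R"
  shows "bij_betw (\<lambda>a. (t \<ominus> (a \<otimes> v \<oplus> s)) \<otimes> inv u) (carrier R) (carrier R)"
proof -
  have solve: "b = (t \<ominus> (a \<otimes> v \<oplus> s)) \<otimes> inv u \<longleftrightarrow> a = (t \<ominus> (b \<otimes> u \<oplus> s)) \<otimes> inv v"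
    if "a \<in> carrier R" "b \<in> carrier R" for a b
  proof -
    have "b \<otimes> u \<oplus> (a \<otimes> v \<oplus> s) = a \<otimes> v \<oplus> (b \<otimes> u \<oplus> s)"
      using that u v s by (simp add: Units_closed a_lcomm)
    then show ?thesis
      using that u v s t
        linear_eq_iff_unique_solution[of u b "a \<otimes> v \<oplus> s" t]
        linear_eq_iff_unique_solution[of v a "b \<otimes> u \<oplus> s" t]
      by (simp add: Units_closed)
  qed
  have closed: "(t \<ominus> (a \<otimes> v' \<oplus> s)) \<otimes> inv u' \<in> carrier R"
    if "a \<in> carrier R" "v' \<in> Units R" "u' \<in> Units R" for a u' v'
    using that s t by (simp add: Units_closed)
  show ?thesis
  proof (rule bij_betw_byWitness[where f' = "\<lambda>b. (t \<ominus> (b \<otimes> u \<oplus> s)) \<otimes> inv v"])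
    show "\<forall>a\<in>carrier R.
        (t \<ominus> ((t \<ominus> (a \<otimes> v \<oplus> s)) \<otimes> inv u \<otimes> u \<oplus> s)) \<otimes> inv v = a"
      using solve[OF _ closed[OF _ v u]] by metis
    show "\<forall>b\<in>carrier R.
        (t \<ominus> ((t \<ominus> (b \<otimes> u \<oplus> s)) \<otimes> inv v \<otimes> v \<oplus> s)) \<otimes> inv u = b"
      using solve[OF closed[OF _ u v]] by metis
  qed (use closed u v in blast)+
qed

lemma finsum_remove_two:
  assumes "finite T" "x \<in> T" "y \<in> T" "x \<noteq> y" "g \<in> T \<rightarrow> carrier R"
  shows "finsum R g T = g x \<oplus> (g y \<oplus> finsum R g (T - {x, y}))"
proof -
  have "finsum R g T = finsum R g (insert x (insert y (T - {x, y})))"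
    using assms(2,3) by (intro arg_cong[where f = "finsum R g"]) blast
  also have "\<dots> = g x \<oplus> (g y \<oplus> finsum R g (T - {x, y}))"
    using assms by (subst finsum_insert; auto simp: Pi_iff)+
  finally show ?thesis .
qed

end

section \<open>The bijections of the basic data\<close>

definition corner_solution ::
  "(nat \<times> nat) set \<Rightarrow> int \<Rightarrow> int \<Rightarrow> (nat \<times> nat \<Rightarrow> int) \<Rightarrow> (nat \<times> nat \<Rightarrow> int) \<Rightarrow> int \<Rightarrow> int" where
  "corner_solution T q t w p a =
     (t \<ominus>\<^bsub>residue_ring q\<^esub> (a \<otimes>\<^bsub>residue_ring q\<^esub> w (corner2 T) \<oplus>\<^bsub>residue_ring q\<^esub>
        (\<Oplus>\<^bsub>residue_ring q\<^esub>i\<in>punctured T. p i \<otimes>\<^bsub>residue_ring q\<^esub> w i)))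
      \<otimes>\<^bsub>residue_ring q\<^esub> inv\<^bsub>residue_ring q\<^esub> (w (corner1 T))"

text \<open>
  A function is determined by its restriction \<open>p\<close> to the punctured tile and its two corner
  values \<open>a\<close>, \<open>b\<close>; it satisfies the vertex equation exactly when \<open>b\<close> is the solution
  determined by \<open>p\<close> and \<open>a\<close>, that is, when it is the function $F_{p,a}$.
\<close>

lemma prw_vertices_eq_bd_vertices:
  assumes T: "tile T" "nondegenerate T"
    and R: "cring (residue_ring q)"
    and t: "t \<in> carrier (residue_ring q)"
    and w: "w \<in> T \<rightarrow> carrier (residue_ring q)"
    and unit1: "w (corner1 T) \<in> Units (residue_ring q)"
  shows "prw_vertices T q t w =
    bd_vertices T (carrier (residue_ring q)) (corner_solution T q t w)"
proof -
  define R where "R = residue_ring q"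
  interpret cring R
    using R by (simp add: R_def)
  let ?x = "corner1 T" and ?y = "corner2 T" and ?P = "punctured T"
  note c = corner1_in_tile[OF T(1)] corner2_in_tile[OF T(1)] corners_distinct[OF T]
  have fin: "finite T"
    using T(1) by (simp add: tile_def)
  have PT: "?P \<subseteq> T"
    by (auto simp: punctured_def)
  have wR: "w i \<in> carrier R" if "i \<in> T" for i
    using w that by (auto simp: R_def)
  have tR: "t \<in> carrier R" and uR: "w ?x \<in> Units R"
    using t unit1 by (auto simp: R_def)
  have rest_closed: "(\<Oplus>\<^bsub>R\<^esub>i\<in>?P. p i \<otimes>\<^bsub>R\<^esub> w i) \<in> carrier R"
    if "p \<in> ?P \<rightarrow> carrier R" for p
    using that PT wR by (intro finsum_closed Pi_I m_closed) (blast dest: Pi_mem)+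
  have sol_closed: "corner_solution T q t w p a \<in> carrier R"
    if "p \<in> ?P \<rightarrow> carrier R" "a \<in> carrier R" for p a
    unfolding corner_solution_def R_def[symmetric]
    using that rest_closed[OF that(1)] c wR tR uR by simp
  have vertex_iff: "(\<Oplus>\<^bsub>R\<^esub>i\<in>T. v i \<otimes>\<^bsub>R\<^esub> w i) = t \<longleftrightarrow>
      v ?x = corner_solution T q t w v (v ?y)" if v: "v \<in> T \<rightarrow> carrier R" for v
  proof -
    have vals: "v ?x \<in> carrier R" "v ?y \<in> carrier R"
      using v c by (blast dest: Pi_mem)+
    have "(\<Oplus>\<^bsub>R\<^esub>i\<in>T. v i \<otimes>\<^bsub>R\<^esub> w i) = v ?x \<otimes>\<^bsub>R\<^esub> w ?x \<oplus>\<^bsub>R\<^esub>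
        (v ?y \<otimes>\<^bsub>R\<^esub> w ?y \<oplus>\<^bsub>R\<^esub> (\<Oplus>\<^bsub>R\<^esub>i\<in>?P. v i \<otimes>\<^bsub>R\<^esub> w i))"
      unfolding punctured_def using fin c v wR
      by (intro finsum_remove_two Pi_I m_closed) (blast dest: Pi_mem)+
    moreover have "(\<Oplus>\<^bsub>R\<^esub>i\<in>?P. v i \<otimes>\<^bsub>R\<^esub> w i) \<in> carrier R"
      using v PT by (intro rest_closed) auto
    ultimately show ?thesis
      unfolding corner_solution_def R_def[symmetric]
      using tR uR vals wR[OF c(2)]
      by (simp add: linear_eq_iff_unique_solution)
  qed
  have sol_cong: "corner_solution T q t w p a = corner_solution T q t w p' a"
    if "\<And>i. i \<in> ?P \<Longrightarrow> p i = p' i" "p' \<in> ?P \<rightarrow> carrier R" for p p' a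
  proof -
    have "(\<Oplus>\<^bsub>R\<^esub>i\<in>?P. p i \<otimes>\<^bsub>R\<^esub> w i) = (\<Oplus>\<^bsub>R\<^esub>i\<in>?P. p' i \<otimes>\<^bsub>R\<^esub> w i)"
      using that PT wR by (intro finsum_cong' Pi_I m_closed) (auto dest: Pi_mem simp del: split_paired_all)
    then show ?thesis
      by (simp add: corner_solution_def R_def)
  qed
  show ?thesis
    unfolding R_def[symmetric]
  proof (intro equalityI subsetI)
    fix v assume "v \<in> prw_vertices T q t w"
    then have v: "v \<in> T \<rightarrow>\<^sub>E carrier R" and eq: "(\<Oplus>\<^bsub>R\<^esub>i\<in>T. v i \<otimes>\<^bsub>R\<^esub> w i) = t"
      by (auto simp: prw_vertices_def R_def)
    have vR: "v \<in> T \<rightarrow> carrier R"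
      using v by (auto simp: PiE_iff)
    let ?p = "restrict v ?P"
    have p: "?p \<in> ?P \<rightarrow>\<^sub>E carrier R"
      using vR PT by auto
    have "v ?x = corner_solution T q t w ?p (v ?y)"
      using eq vertex_iff[OF vR] sol_cong[of v ?p] p by (auto simp: PiE_iff Pi_iff)
    then have "bd_vertex T (corner_solution T q t w) ?p (v ?y) i = v i" for i
      using PiE_arb[OF v, of i] by (cases "i \<in> T") (simp_all add: bd_vertex_def punctured_def)
    then have "v = bd_vertex T (corner_solution T q t w) ?p (v ?y)"
      by auto
    then show "v \<in> bd_vertices T (carrier R) (corner_solution T q t w)"
      using p vR c unfolding bd_vertices_def by blast
  next
    fix v assume "v \<in> bd_vertices T (carrier R) (corner_solution T q t w)"
    then obtain p a where p: "p \<in> ?P \<rightarrow>\<^sub>E carrier R" and a: "a \<in> carrier R"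
      and v: "v = bd_vertex T (corner_solution T q t w) p a"
      by (auto simp: bd_vertices_def)
    have pR: "p \<in> ?P \<rightarrow> carrier R"
      using p by (auto simp: PiE_iff)
    have vE: "v \<in> T \<rightarrow>\<^sub>E carrier R"
      using pR a sol_closed[OF pR a] by (auto simp: v bd_vertex_def punctured_def)
    then have vR: "v \<in> T \<rightarrow> carrier R"
      by (auto simp: PiE_iff)
    have vy: "v ?y = a" and vx: "v ?x = corner_solution T q t w p a"
      using c by (auto simp: v bd_vertex_def)
    have "corner_solution T q t w v a = corner_solution T q t w p a"
      using pR by (intro sol_cong) (auto simp: v bd_vertex_def punctured_def)
    then have "(\<Oplus>\<^bsub>R\<^esub>i\<in>T. v i \<otimes>\<^bsub>R\<^esub> w i) = t"
      using vertex_iff[OF vR] vx vy by simp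
    then show "v \<in> prw_vertices T q t w"
      using vE by (simp add: prw_vertices_def R_def)
  qed
qed

lemma two_graph_isomorphic_refl: "G \<cong>\<^sub>2 G"
  unfolding two_graph_isomorphic_def
  by (rule exI[of _ id], rule exI[of _ id]) simp

theorem proposition3p10:
  fixes T :: "(nat \<times> nat) set" and q t :: int and w :: "nat \<times> nat \<Rightarrow> int"
  assumes "tile T" and "nondegenerate T"
    and "q \<ge> 2"
    and "t \<in> carrier (residue_ring q)"
    and "w \<in> T \<rightarrow> carrier (residue_ring q)"
    and "w (corner1 T) \<in> Units (residue_ring q)"
    and "w (corner2 T) \<in> Units (residue_ring q)"
  shows "\<exists>f. basic_data T (carrier (residue_ring q)) f \<and>
             prw_graph T q t w \<cong>\<^sub>2 bd_graph T (carrier (residue_ring q)) f"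
proof (intro exI conjI)
  let ?R = "residue_ring q" and ?f = "corner_solution T q t w"
  interpret residues q ?R
    using assms(3) by unfold_locales auto
  have "bij_betw (?f p) (carrier ?R) (carrier ?R)" if p: "p \<in> punctured T \<rightarrow>\<^sub>E carrier ?R" for p
  proof -
    have "(\<Oplus>\<^bsub>?R\<^esub>i\<in>punctured T. p i \<otimes>\<^bsub>?R\<^esub> w i) \<in> carrier ?R"
      using p assms(5) by (intro finsum_closed Pi_I m_closed) (auto simp: punctured_def PiE_iff)
    from bij_betw_corner_solution[OF assms(6,7) this assms(4)] show ?thesis
      unfolding corner_solution_def .
  qed
  moreover have "carrier ?R \<noteq> {}"
    using zero_closed by blast
  ultimately show "basic_data T (carrier ?R) ?f"
    using assms(1,2) finite by (simp add: basic_data_def)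
  show "prw_graph T q t w \<cong>\<^sub>2 bd_graph T (carrier ?R) ?f"
    unfolding prw_graph_def bd_graph_def
    using prw_vertices_eq_bd_vertices[OF assms(1,2) cring assms(4-6)]
    by (simp add: two_graph_isomorphic_refl)
qed

end
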